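(* Let $d\in\mathbb{N}$, let $\Omega\subset\mathbb{R}^d$ be bounded, $\tau>d/2$ and $\sigma\in(\frac{d}{2\tau},1]$. Let $k(x,z)=\Phi(x-z)$ and $k^{(\sigma)}(x,z)=\Phi^{(\sigma)}(x-z)$ be the translational invariant kernels with $\hat\Phi(\omega)=(1+\Vert\omega\Vert^2)^{-\tau}$ and $\hat\Phi^{(\sigma)}(\omega)=(1+\Vert\omega\Vert^2)^{-\sigma\tau}$ for all $\omega\in\mathbb{R}^d$. Then there is a constant $c_\sigma'>0$, depending only on $\sigma,d,\tau,\Omega$, with the following property. Let $\tilde k,\tilde k^{(\sigma)}:\Omega\times\Omega\to\mathbb{R}$ be kernels that are norm-equivalent on $\Omega$ to $k$ and $k^{(\sigma)}$ respectively, i.e. $\mathcal{H}_{\tilde k}(\Omega)=\mathcal{H}_k(\Omega)$ and $\mathcal{H}_{\tilde k^{(\sigma)}}(\Omega)=\mathcal{H}_{k^{(\sigma)}}(\Omega)$ as sets and, for some constants $C,C_1>0$, $$C^{-1}\Vert\cdot\Vert_{\mathcal{H}_k(\Omega)}\le\Vert\cdot\Vert_{\mathcal{H}_{\tilde k}(\Omega)}\le C\Vert\cdot\Vert_{\mathcal{H}_k(\Omega)},\qquad C_1^{-1}\Vert\cdot\Vert_{\mathcal{H}_{k^{(\sigma)}}(\Omega)}\le\Vert\cdot\Vert_{\mathcal{H}_{\tilde k^{(\sigma)}}(\Omega)}\le C_1\Vert\cdot\Vert_{\mathcal{H}_{k^{(\sigma)}}(\Omega)} .$$ Then for every finite set $X\subset\Omega$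 of pairwise distinct points, the kernel matrices $\tilde A=\tilde k(X,X)$ and $\tilde A^{(\sigma)}=\tilde k^{(\sigma)}(X,X)$ satisfy, for all $0\ne\alpha\in\mathbb{R}^{|X|}$, $$C_1^{-2}C^{-2}\cdot\frac{\alpha^\top\tilde A\alpha}{\Vert\alpha\Vert^2}\ \le\ \frac{\alpha^\top\tilde A^{(\sigma)}\alpha}{\Vert\alpha\Vert^2}\ \le\ C_1^2C^2\cdot c_\sigma'\,q_X^{-(1-\sigma)2\tau}\cdot\frac{\alpha^\top\tilde A\alpha}{\Vert\alpha\Vert^2}.$$
   Context: The kernel matrix of a kernel $k$ on $X=\{x_1,\dots,x_{|X|}\}$ is $k(X,X)=(k(x_i,x_j))_{i,j}$. $\mathcal{H}_k(\Omega)$ denotes the reproducing kernel Hilbert space of the positive definite kernel $k$ (restricted to $\Omega\times\Omega$). The separation distance of $X$ (with at least two points) is $q_X:=\min_{x_i\ne x_j\in X}\Vert x_i-x_j\Vert$, with $\Vert\cdot\Vert$ the Euclidean norm. A function $\Phi$ and its Fourier transform $\hat\Phi$ are related by $\Phi(x)=(2\pi)^{-d/2}\int_{\mathbb{R}^d}\hat\Phi(\omega)e^{i\omega^\top x}\,\mathrm{d}\omega$ for all $x\in\mathbb{R}^d$. *)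

theory Defs
  imports "HOL-Analysis.Analysis"
begin

(* The Fourier transform convention is symmetric: the factor (2 pi)^(-d/2) is part of the
   inversion formula.  Integrability is required explicitly because the Bochner integral of a
   non-integrable function is 0 by convention. *)
definition fourier_pair :: "(real^'d \<Rightarrow> real) \<Rightarrow> (real^'d \<Rightarrow> real) \<Rightarrow> bool" where
  "fourier_pair \<Phi> \<Phi>hat \<longleftrightarrow>
     integrable lborel \<Phi>hat \<and>
     (\<forall>x. complex_of_real (\<Phi> x) =
        complex_of_real ((2 * pi) powr (- (real CARD('d) / 2))) *
        (LINT \<omega>|lborel. complex_of_real (\<Phi>hat \<omega>) * exp (\<i> * complex_of_real (\<omega> \<bullet> x))))"

(* H with inner product ip is the reproducing kernel Hilbert space of the kernel k on \<Omega>.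
   A function on \<Omega> is represented by its extension by 0 to the whole type, so that equality
   and linear combinations in H are those of functions on \<Omega>.  Only the values of k on
   \<Omega> x \<Omega> and those of ip on H x H matter.  By Moore-Aronszajn, such H exists exactly when k
   is symmetric and positive (semi)definite on \<Omega>, and then H, and ip on H, are unique. *)
locale rkhs =
  fixes \<Omega> :: "'a set"
    and k :: "'a \<Rightarrow> 'a \<Rightarrow> real"
    and H :: "('a \<Rightarrow> real) set"
    and ip :: "('a \<Rightarrow> real) \<Rightarrow> ('a \<Rightarrow> real) \<Rightarrow> real"
  assumes vanishes_outside: "\<And>f x. f \<in> H \<Longrightarrow> x \<notin> \<Omega> \<Longrightarrow> f x = 0"
    and zero_mem: "(\<lambda>x. 0) \<in> H"
    and add_mem: "\<And>f g. f \<in> H \<Longrightarrow> g \<in> H \<Longrightarrow> (\<lambda>x. f x + g x) \<in> H"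
    and scale_mem: "\<And>c f. f \<in> H \<Longrightarrow> (\<lambda>x. c * f x) \<in> H"
    and ip_commute: "\<And>f g. f \<in> H \<Longrightarrow> g \<in> H \<Longrightarrow> ip f g = ip g f"
    and ip_add_left: "\<And>f g h. f \<in> H \<Longrightarrow> g \<in> H \<Longrightarrow> h \<in> H \<Longrightarrow>
           ip (\<lambda>x. f x + g x) h = ip f h + ip g h"
    and ip_scale_left: "\<And>c f h. f \<in> H \<Longrightarrow> h \<in> H \<Longrightarrow> ip (\<lambda>x. c * f x) h = c * ip f h"
    and ip_nonneg: "\<And>f. f \<in> H \<Longrightarrow> 0 \<le> ip f f"
    and ip_definite: "\<And>f. f \<in> H \<Longrightarrow> ip f f = 0 \<Longrightarrow> f = (\<lambda>x. 0)"
    and complete: "\<And>s :: nat \<Rightarrow> 'a \<Rightarrow> real.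
           (\<And>n. s n \<in> H) \<Longrightarrow>
           (\<And>e. e > 0 \<Longrightarrow> \<exists>N. \<forall>m\<ge>N. \<forall>n\<ge>N.
              sqrt (ip (\<lambda>x. s m x - s n x) (\<lambda>x. s m x - s n x)) < e) \<Longrightarrow>
           \<exists>f\<in>H. (\<lambda>n. sqrt (ip (\<lambda>x. s n x - f x) (\<lambda>x. s n x - f x))) \<longlonglongrightarrow> 0"
    and kernel_mem: "\<And>z. z \<in> \<Omega> \<Longrightarrow> (\<lambda>x. if x \<in> \<Omega> then k x z else 0) \<in> H"
    and reproducing: "\<And>f z. f \<in> H \<Longrightarrow> z \<in> \<Omega> \<Longrightarrow>
           f z = ip f (\<lambda>x. if x \<in> \<Omega> then k x z else 0)"

(* The RKHS of k and of kt coincide as sets and their norms are equivalent with constant C.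
   The existential quantifiers merely name the unique RKHS of k and of kt. *)
definition norm_equivalent_on ::
    "'a set \<Rightarrow> real \<Rightarrow> ('a \<Rightarrow> 'a \<Rightarrow> real) \<Rightarrow> ('a \<Rightarrow> 'a \<Rightarrow> real) \<Rightarrow> bool" where
  "norm_equivalent_on \<Omega> C k kt \<longleftrightarrow>
     (\<exists>H ip Ht ipt. rkhs \<Omega> k H ip \<and> rkhs \<Omega> kt Ht ipt \<and> Ht = H \<and>
        (\<forall>f\<in>H. inverse C * sqrt (ip f f) \<le> sqrt (ipt f f) \<and>
                sqrt (ipt f f) \<le> C * sqrt (ip f f)))"

(* The minimum is meaningful only if X is finite and has at least two points. *)
definition separation_distance :: "'a::real_normed_vector set \<Rightarrow> real" where
  "separation_distance X = Min {norm (x - z) | x z. x \<in> X \<and> z \<in> X \<and> x \<noteq> z}"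

(* alpha^T A alpha / |alpha|^2 for the kernel matrix A = k(X,X).  Rows, columns and the entries
   of alpha are indexed by the points of the finite set X instead of by an enumeration of X;
   L2_set \<alpha> X is the Euclidean norm of the vector (\<alpha> x), x in X. *)
definition kernel_rayleigh_quotient ::
    "('a \<Rightarrow> 'a \<Rightarrow> real) \<Rightarrow> 'a set \<Rightarrow> ('a \<Rightarrow> real) \<Rightarrow> real" where
  "kernel_rayleigh_quotient k X \<alpha> =
     (\<Sum>x\<in>X. \<Sum>z\<in>X. \<alpha> x * k x z * \<alpha> z) / (L2_set \<alpha> X)\<^sup>2"

end

theory Submission
  imports Defs "HOL-Probability.Characteristic_Functions"
begin

text \<open>Put \<open>s = \<sigma>\<tau>\<close>, \<open>h = d/2\<close> and \<open>P(\<omega>) = \<bar>\<Sum>x\<in>X. \<alpha> x exp (i \<omega>\<cdot>x)\<bar>\<^sup>2\<close>.  Three ideas give the two bounds.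

Norm equivalence.  The quadratic form of a kernel matrix is the squared norm of the element that
represents the functional \<open>f \<mapsto> \<Sum>x\<in>X. \<alpha> x f(x)\<close> in the native space.  The same functional is
represented in both inner products, so the Cauchy-Schwarz inequality turns norm equivalence with
constant \<open>C\<close> into equivalence of the quadratic forms with constant \<open>C\<^sup>2\<close>
(\<open>norm_equivalent_on_kernel_rayleigh_quotient\<close>).  This leaves the two Bessel kernels themselves.

Fourier side.  Up to the factor \<open>(2\<pi>)\<^sup>h\<close>, the quadratic form of a translation invariant kernel is
the integral of \<open>P\<close> against its Fourier transform (\<open>fourier_pair_quadratic_form\<close>).  The lower bound is
then the pointwise inequality \<open>(1 + \<bar>\<omega>\<bar>\<^sup>2) powr (-\<tau>) \<le> (1 + \<bar>\<omega>\<bar>\<^sup>2) powr (-s)\<close>.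

Inverse inequality.  For the upper bound, \<open>P\<close> is tested against Gaussians.  The integral of
\<open>exp (- t \<bar>\<omega>\<bar>\<^sup>2) P(\<omega>)\<close> is \<open>(\<pi>/t)\<^sup>h\<close> times a quadratic form with entries
\<open>exp (- \<bar>x - z\<bar>\<^sup>2 / (4 t))\<close>.  If \<open>t\<close> is at most a small multiple of \<open>q\<^sup>2\<close>, where \<open>q\<close> is the separation
distance, a packing argument makes this matrix diagonally dominant, so the integral lies between
\<open>1/2\<close> and \<open>3/2\<close> times \<open>(\<pi>/t)\<^sup>h \<Sum>x\<in>X. (\<alpha> x)\<^sup>2\<close> (\<open>gaussian_trig_energy_bounds\<close>).  Fix such a \<open>t\<close>
proportional to \<open>q\<^sup>2\<close>.  At frequencies \<open>\<bar>\<omega>\<bar>\<^sup>2 \<le> 1/t\<close> the weight with exponent \<open>s\<close> exceeds the one with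
exponent \<open>\<tau>\<close> at most by the factor \<open>(1 + 1/t) powr (\<tau> - s)\<close>, which for bounded \<open>q\<close> is of the order of
the claimed power of \<open>q\<close>.  The high frequencies are split dyadically and dominated by Gaussians with
parameters \<open>t/4\<^sup>k\<close>; the Gaussian upper bounds sum to a geometric series, convergent because \<open>s > h\<close>, whose value is a multiple of
\<open>t powr (s - h) \<Sum>x\<in>X. (\<alpha> x)\<^sup>2\<close>.  Finally the weight with exponent \<open>\<tau>\<close> dominates a multiple of
\<open>t powr \<tau> exp (- t \<bar>\<omega>\<bar>\<^sup>2)\<close>, so the Gaussian lower bound controls \<open>\<Sum>x\<in>X. (\<alpha> x)\<^sup>2\<close> by
\<open>t powr (h - \<tau>)\<close> times the quadratic form to be compared with
(\<open>bessel_weighted_integral_comparison\<close>).  Boundedness of \<open>\<Omega>\<close> bounds \<open>q\<close>, hence \<open>t\<close>, and makes the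
constants uniform in \<open>X\<close>.\<close>

section \<open>Quadratic forms of kernel matrices with equivalent native norms\<close>

context rkhs
begin

lemma linear_combination_mem:
  assumes "finite X" "\<And>z. z \<in> X \<Longrightarrow> f z \<in> H"
  shows "(\<lambda>x. \<Sum>z\<in>X. a z * f z x) \<in> H"
  using assms
proof (induction X rule: finite_induct)
  case empty
  show ?case using zero_mem by simp
next
  case (insert z X)
  thus ?case using add_mem[OF scale_mem, of "f z" "\<lambda>x. \<Sum>z\<in>X. a z * f z x" "a z"] by simp
qed

lemma ip_linear_combination_left:
  assumes "finite X" "\<And>z. z \<in> X \<Longrightarrow> f z \<in> H" "h \<in> H"
  shows "ip (\<lambda>x. \<Sum>z\<in>X. a z * f z x) h = (\<Sum>z\<in>X. a z * ip (f z) h)"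
  using assms
proof (induction X rule: finite_induct)
  case empty
  show ?case using ip_scale_left[OF zero_mem, of h 0] empty by simp
next
  case (insert z X)
  thus ?case
    using ip_add_left[OF scale_mem linear_combination_mem, of "f z" X f h "a z" a]
      ip_scale_left[of "f z" h "a z"] by simp
qed

lemma Cauchy_Schwarz:
  assumes f: "f \<in> H" and g: "g \<in> H"
  shows "(ip f g)\<^sup>2 \<le> ip f f * ip g g"
proof (cases "ip g g = 0")
  case True
  hence "g = (\<lambda>x. 0)" using g ip_definite by blast
  hence "ip f g = 0" using ip_scale_left[OF zero_mem f, of 0] ip_commute[OF f g] by simp
  thus ?thesis using True by simp
next
  case False
  hence pos: "ip g g > 0" using ip_nonneg[OF g] by simp
  \<comment> \<open>the minimiser of the squared norm of \<open>f + t g\<close>\<close>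
  define t where "t = - ip f g / ip g g"
  let ?tg = "\<lambda>x. t * g x"
  have tg: "?tg \<in> H" using g by (rule scale_mem)
  have sum: "(\<lambda>x. f x + ?tg x) \<in> H" using f tg by (rule add_mem)
  have expand: "ip (\<lambda>x. f x + ?tg x) h = ip f h + t * ip g h" if "h \<in> H" for h
    using ip_add_left[OF f tg that] ip_scale_left[OF g that] by simp
  have "0 \<le> ip (\<lambda>x. f x + ?tg x) (\<lambda>x. f x + ?tg x)" using sum by (rule ip_nonneg)
  also have "\<dots> = ip (\<lambda>x. f x + ?tg x) f + t * ip (\<lambda>x. f x + ?tg x) g"
    using expand[OF sum] ip_commute[OF sum f] ip_commute[OF sum g] by simp
  also have "\<dots> = ip f f + 2 * t * ip f g + t\<^sup>2 * ip g g"
    using expand[OF f] expand[OF g] ip_commute[OF f g]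
    by (simp add: algebra_simps power2_eq_square)
  also have "\<dots> = ip f f - (ip f g)\<^sup>2 / ip g g"
    using pos by (simp add: t_def power2_eq_square field_simps)
  finally show ?thesis using pos by (simp add: field_simps)
qed

text \<open>The Riesz representer of the functional \<open>f \<mapsto> \<Sum>x\<in>X. \<alpha> x f(x)\<close>.\<close>

definition representer where
  "representer X \<alpha> = (\<lambda>x. \<Sum>z\<in>X. \<alpha> z * (if x \<in> \<Omega> then k x z else 0))"

lemma representer_mem:
  assumes "finite X" "X \<subseteq> \<Omega>"
  shows "representer X \<alpha> \<in> H"
  unfolding representer_def
  using linear_combination_mem[of X "\<lambda>z x. if x \<in> \<Omega> then k x z else 0"] assms kernel_mem by blast

lemma ip_representer:
  assumes "finite X" "X \<subseteq> \<Omega>" "f \<in> H"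
  shows "ip f (representer X \<alpha>) = (\<Sum>x\<in>X. \<alpha> x * f x)"
proof -
  let ?k = "\<lambda>z x. if x \<in> \<Omega> then k x z else 0"
  have km: "?k z \<in> H" if "z \<in> X" for z using that assms kernel_mem by blast
  have "ip f (representer X \<alpha>) = ip (representer X \<alpha>) f"
    using assms representer_mem ip_commute by blast
  also have "\<dots> = (\<Sum>z\<in>X. \<alpha> z * ip (?k z) f)"
    unfolding representer_def using ip_linear_combination_left[of X ?k f] assms km by blast
  also have "\<dots> = (\<Sum>z\<in>X. \<alpha> z * f z)"
    using assms km reproducing ip_commute by (intro sum.cong) (auto simp: subset_iff)
  finally show ?thesis .
qed

lemma kernel_quadratic_form:
  assumes "finite X" "X \<subseteq> \<Omega>"
  shows "(\<Sum>x\<in>X. \<Sum>z\<in>X. \<alpha> x * k x z * \<alpha> z) = ip (representer X \<alpha>) (representer X \<alpha>)"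
  unfolding ip_representer[OF assms representer_mem[OF assms]]
  using assms by (auto simp: representer_def sum_distrib_left mult_ac intro!: sum.cong)

end

text \<open>Let \<open>g\<close> and \<open>gt\<close> represent the functional \<open>f \<mapsto> \<Sum>x\<in>X. \<alpha> x f(x)\<close> in the two inner products.  Then
\<open>ipt gt gt = ip gt g\<close>, and the Cauchy-Schwarz inequality for \<open>ip\<close> together with the domination of
\<open>ip\<close> by \<open>ipt\<close> gives \<open>(ipt gt gt)\<^sup>2 \<le> B * ipt gt gt * ip g g\<close>; it remains to cancel a factor.\<close>

lemma kernel_quadratic_form_mono:
  assumes "rkhs \<Omega> k H ip" "rkhs \<Omega> kt H ipt"
    and dom: "\<And>f. f \<in> H \<Longrightarrow> ip f f \<le> B * ipt f f"
    and X: "finite X" "X \<subseteq> \<Omega>"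
  shows "(\<Sum>x\<in>X. \<Sum>z\<in>X. \<alpha> x * kt x z * \<alpha> z) \<le> B * (\<Sum>x\<in>X. \<Sum>z\<in>X. \<alpha> x * k x z * \<alpha> z)"
proof -
  interpret A: rkhs \<Omega> k H ip by fact
  interpret B: rkhs \<Omega> kt H ipt by fact
  define g where "g = A.representer X \<alpha>"
  define gt where "gt = B.representer X \<alpha>"
  have mem: "g \<in> H" "gt \<in> H"
    unfolding g_def gt_def using A.representer_mem B.representer_mem X by auto
  have eq: "ipt gt gt = ip gt g"
    using A.ip_representer[OF X mem(2)] B.ip_representer[OF X mem(2)] by (simp add: g_def gt_def)
  have nn: "0 \<le> ip g g" "0 \<le> ipt gt gt" "0 \<le> ip gt gt"
    using mem A.ip_nonneg B.ip_nonneg by auto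
  have "(ipt gt gt)\<^sup>2 \<le> ip gt gt * ip g g" unfolding eq using A.Cauchy_Schwarz mem by blast
  also have "\<dots> \<le> (B * ipt gt gt) * ip g g" using dom[OF mem(2)] nn by (intro mult_right_mono)
  finally have sq: "ipt gt gt * ipt gt gt \<le> ipt gt gt * (B * ip g g)"
    by (simp add: power2_eq_square mult_ac)
  have "ipt gt gt \<le> B * ip g g"
  proof (cases "ipt gt gt = 0")
    case True
    \<comment> \<open>Nothing can be cancelled here and \<open>B\<close> may be negative; but then the functional vanishes,
        so that \<open>g\<close> is zero in norm as well.\<close>
    hence "gt = (\<lambda>x. 0)" using mem B.ip_definite by blast
    moreover have "ip g g = ipt g gt"
      using A.ip_representer[OF X mem(1)] B.ip_representer[OF X mem(1)] by (simp add: g_def gt_def)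
    moreover have "ipt g (\<lambda>x. 0) = 0"
      using B.ip_scale_left[OF B.zero_mem mem(1), of 0] B.ip_commute[OF mem(1) B.zero_mem] by simp
    ultimately show ?thesis using True by simp
  next
    case False
    thus ?thesis using sq nn by (simp add: mult_le_cancel_left)
  qed
  thus ?thesis
    using A.kernel_quadratic_form[OF X] B.kernel_quadratic_form[OF X] by (simp add: g_def gt_def)
qed

lemma norm_equivalent_on_kernel_rayleigh_quotient:
  assumes "norm_equivalent_on \<Omega> C k kt" "C > 0" "finite X" "X \<subseteq> \<Omega>"
  shows "kernel_rayleigh_quotient kt X \<alpha> \<le> C\<^sup>2 * kernel_rayleigh_quotient k X \<alpha>"
    and "kernel_rayleigh_quotient k X \<alpha> \<le> C\<^sup>2 * kernel_rayleigh_quotient kt X \<alpha>"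
proof -
  obtain H ip ipt where r: "rkhs \<Omega> k H ip" "rkhs \<Omega> kt H ipt"
    and b: "\<And>f. f \<in> H \<Longrightarrow> inverse C * sqrt (ip f f) \<le> sqrt (ipt f f)"
           "\<And>f. f \<in> H \<Longrightarrow> sqrt (ipt f f) \<le> C * sqrt (ip f f)"
    using assms(1) unfolding norm_equivalent_on_def by blast
  have nn: "0 \<le> ip f f" "0 \<le> ipt f f" if "f \<in> H" for f
    using r that rkhs.ip_nonneg by metis+
  have "ip f f \<le> C\<^sup>2 * ipt f f" if "f \<in> H" for f
  proof -
    have "sqrt (ip f f) \<le> C * sqrt (ipt f f)" using b(1)[OF that] assms(2) by (simp add: field_simps)
    hence "(sqrt (ip f f))\<^sup>2 \<le> (C * sqrt (ipt f f))\<^sup>2" using nn that by (intro power_mono) auto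
    thus ?thesis using nn[OF that] by (simp add: power_mult_distrib)
  qed
  from kernel_quadratic_form_mono[OF r this assms(3,4)]
  show "kernel_rayleigh_quotient kt X \<alpha> \<le> C\<^sup>2 * kernel_rayleigh_quotient k X \<alpha>"
    unfolding kernel_rayleigh_quotient_def by (simp add: divide_right_mono)
  have "ipt f f \<le> C\<^sup>2 * ip f f" if "f \<in> H" for f
  proof -
    have "(sqrt (ipt f f))\<^sup>2 \<le> (C * sqrt (ip f f))\<^sup>2" using b(2) nn that by (intro power_mono) auto
    thus ?thesis using nn[OF that] by (simp add: power_mult_distrib)
  qed
  from kernel_quadratic_form_mono[OF r(2,1) this assms(3,4)]
  show "kernel_rayleigh_quotient k X \<alpha> \<le> C\<^sup>2 * kernel_rayleigh_quotient kt X \<alpha>"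
    unfolding kernel_rayleigh_quotient_def by (simp add: divide_right_mono)
qed

section \<open>Fourier representation of the quadratic form\<close>

lemma has_bochner_integral_mono:
  fixes f g :: "'a \<Rightarrow> real"
  assumes "has_bochner_integral M f a" "has_bochner_integral M g b" "\<And>x. f x \<le> g x"
  shows "a \<le> b"
proof -
  have "integral\<^sup>L M f \<le> integral\<^sup>L M g"
    using assms by (intro integral_mono) (simp_all add: has_bochner_integral_iff)
  thus ?thesis using assms(1,2) by (simp add: has_bochner_integral_iff)
qed

text \<open>This is \<open>\<bar>\<Sum>x\<in>X. \<alpha> x exp (i \<omega>\<cdot>x)\<bar>\<^sup>2\<close>, written with real functions so that all integrals below are
  real.\<close>

definition trig_energy :: "('a::euclidean_space \<Rightarrow> real) \<Rightarrow> 'a set \<Rightarrow> 'a \<Rightarrow> real" where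
  "trig_energy \<alpha> X \<omega> = (\<Sum>x\<in>X. \<alpha> x * cos (\<omega> \<bullet> x))\<^sup>2 + (\<Sum>x\<in>X. \<alpha> x * sin (\<omega> \<bullet> x))\<^sup>2"

lemma trig_energy_nonneg: "trig_energy \<alpha> X \<omega> \<ge> 0"
  by (simp add: trig_energy_def)

lemma trig_energy_eq:
  "trig_energy \<alpha> X \<omega> = (\<Sum>x\<in>X. \<Sum>z\<in>X. \<alpha> x * cos (\<omega> \<bullet> (x - z)) * \<alpha> z)"
  unfolding trig_energy_def power2_eq_square sum_product inner_diff_right cos_diff
  by (simp add: sum.distrib[symmetric] algebra_simps)

text \<open>If \<open>K\<close> is the cosine transform of \<open>w\<close>, the quadratic form of the kernel \<open>K(x - z)\<close> is the energy with
weight \<open>w\<close>.  It serves for the Bessel weights as well as for the Gaussians.\<close>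

lemma integral_weighted_trig_energy:
  assumes "\<And>y. has_bochner_integral lborel (\<lambda>\<omega>. w \<omega> * cos (\<omega> \<bullet> y)) (K y)"
  shows "has_bochner_integral lborel (\<lambda>\<omega>. w \<omega> * trig_energy \<alpha> X \<omega>)
           (\<Sum>x\<in>X. \<Sum>z\<in>X. \<alpha> x * K (x - z) * \<alpha> z)"
proof -
  have "has_bochner_integral lborel (\<lambda>\<omega>. \<Sum>x\<in>X. \<Sum>z\<in>X. \<alpha> x * (w \<omega> * cos (\<omega> \<bullet> (x - z))) * \<alpha> z)
           (\<Sum>x\<in>X. \<Sum>z\<in>X. \<alpha> x * K (x - z) * \<alpha> z)"
    using assms
    by (intro has_bochner_integral_sum has_bochner_integral_mult_left has_bochner_integral_mult_right)
  thus ?thesis by (simp add: trig_energy_eq sum_distrib_left mult_ac)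
qed

text \<open>Since \<open>\<Phi>\<close> and \<open>w\<close> are real, only the real part of the inversion formula matters.\<close>

lemma fourier_pair_cos_integral:
  fixes \<Phi> w :: "real^'d \<Rightarrow> real"
  assumes "fourier_pair \<Phi> w"
  shows "has_bochner_integral lborel (\<lambda>\<omega>. w \<omega> * cos (\<omega> \<bullet> x)) ((2 * pi) powr (real CARD('d) / 2) * \<Phi> x)"
proof -
  let ?F = "\<lambda>\<omega>. complex_of_real (w \<omega>) * exp (\<i> * complex_of_real (\<omega> \<bullet> x))"
  have w: "integrable lborel w"
    and eq: "complex_of_real (\<Phi> x) = complex_of_real ((2 * pi) powr (- (real CARD('d) / 2))) * (LINT \<omega>|lborel. ?F \<omega>)"
    using assms unfolding fourier_pair_def by auto
  have wm: "w \<in> borel_measurable borel" using w by auto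
  have "integrable lborel ?F"
  proof (rule Bochner_Integration.integrable_bound[OF w])
    show "?F \<in> borel_measurable lborel" using wm by measurable
    show "AE \<omega> in lborel. norm (?F \<omega>) \<le> norm (w \<omega>)" by (simp add: norm_mult)
  qed
  moreover have "(2 * pi) powr (real CARD('d) / 2) * (2 * pi) powr (- (real CARD('d) / 2)) = 1"
    by (simp add: powr_minus)
  hence "complex_of_real ((2 * pi) powr (real CARD('d) / 2)) * complex_of_real ((2 * pi) powr (- (real CARD('d) / 2))) = 1"
    by (metis of_real_1 of_real_mult)
  hence "(LINT \<omega>|lborel. ?F \<omega>) = complex_of_real ((2 * pi) powr (real CARD('d) / 2) * \<Phi> x)"
    by (simp only: of_real_mult eq mult.assoc[symmetric]) simp
  ultimately have "has_bochner_integral lborel ?F (complex_of_real ((2 * pi) powr (real CARD('d) / 2) * \<Phi> x))"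
    by (simp add: has_bochner_integral_iff)
  from has_bochner_integral_bounded_linear[OF bounded_linear_Re this]
  show ?thesis by (simp add: exp_eq_polar flip: cis_conv_exp)
qed

lemma fourier_pair_quadratic_form:
  fixes \<Phi> w :: "real^'d \<Rightarrow> real"
  assumes "fourier_pair \<Phi> w"
  shows "has_bochner_integral lborel (\<lambda>\<omega>. w \<omega> * trig_energy \<alpha> X \<omega>)
           ((2 * pi) powr (real CARD('d) / 2) * (\<Sum>x\<in>X. \<Sum>z\<in>X. \<alpha> x * \<Phi> (x - z) * \<alpha> z))"
proof -
  define N where "N = (2 * pi) powr (real CARD('d) / 2)"
  have "N * (\<Sum>x\<in>X. \<Sum>z\<in>X. \<alpha> x * \<Phi> (x - z) * \<alpha> z)
      = (\<Sum>x\<in>X. \<Sum>z\<in>X. \<alpha> x * (N * \<Phi> (x - z)) * \<alpha> z)"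
    unfolding sum_distrib_left by (intro sum.cong refl) simp
  thus ?thesis
    using integral_weighted_trig_energy[OF fourier_pair_cos_integral[OF assms], of \<alpha> X]
    unfolding N_def by simp
qed

lemma kernel_rayleigh_quotient_fourier_mono:
  fixes \<Phi> \<Phi>' w w' :: "real^'d \<Rightarrow> real"
  assumes "fourier_pair \<Phi> w" "fourier_pair \<Phi>' w'" and "\<And>\<omega>. w \<omega> \<le> w' \<omega>"
  shows "kernel_rayleigh_quotient (\<lambda>x z. \<Phi> (x - z)) X \<alpha> \<le> kernel_rayleigh_quotient (\<lambda>x z. \<Phi>' (x - z)) X \<alpha>"
proof -
  have "(2 * pi) powr (real CARD('d) / 2) * (\<Sum>x\<in>X. \<Sum>z\<in>X. \<alpha> x * \<Phi> (x - z) * \<alpha> z)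
      \<le> (2 * pi) powr (real CARD('d) / 2) * (\<Sum>x\<in>X. \<Sum>z\<in>X. \<alpha> x * \<Phi>' (x - z) * \<alpha> z)"
    by (rule has_bochner_integral_mono[OF fourier_pair_quadratic_form[OF assms(1)]
          fourier_pair_quadratic_form[OF assms(2)]])
      (intro mult_right_mono assms(3) trig_energy_nonneg)
  thus ?thesis
    unfolding kernel_rayleigh_quotient_def by (simp add: divide_right_mono)
qed

section \<open>Fourier transform of the Gaussian\<close>

text \<open>This is the characteristic function of the standard normal distribution after rescaling the variable
by \<open>sqrt (2 t)\<close>.\<close>

lemma gaussian_fourier_real:
  fixes t x :: real
  assumes t: "t > 0"
  shows "has_bochner_integral lborel (\<lambda>\<omega>. of_real (exp (- t * \<omega>\<^sup>2)) * cis (\<omega> * x))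
           (complex_of_real (sqrt (pi / t) * exp (- x\<^sup>2 / (4 * t))))"
proof -
  define c where "c = sqrt (2 * t)"
  have c: "c > 0" "c\<^sup>2 = 2 * t" using t by (auto simp: c_def)
  define y where "y = x / c"
  define f where "f = (\<lambda>u. std_normal_density u *\<^sub>R cis (y * u))"
  have int: "integrable lborel f"
  proof (rule Bochner_Integration.integrable_bound)
    show "integrable lborel std_normal_density"
      by (simp add: integrable_normal_density)
    show "f \<in> borel_measurable lborel" unfolding f_def cis_conv_exp by measurable
    show "AE u in lborel. norm (f u) \<le> norm (std_normal_density u)"
      by (auto simp: f_def)
  qed
  have "char std_normal_distribution y = (LINT u|lborel. f u)"
    unfolding char_def f_def
    by (subst integral_density) (auto simp: cis_conv_exp mult.commute)
  hence val: "(LINT u|lborel. f u) = of_real (exp (- (y\<^sup>2) / 2))"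
    by (simp add: char_std_normal_distribution)
  have fc: "f (0 + c * \<omega>) = of_real (1 / sqrt (2 * pi)) * (of_real (exp (- t * \<omega>\<^sup>2)) * cis (\<omega> * x))" for \<omega>
    using c unfolding f_def std_normal_density_def y_def
    by (simp add: scaleR_conv_of_real power_mult_distrib mult.commute)
  let ?g = "\<lambda>\<omega>. of_real (exp (- t * \<omega>\<^sup>2)) * cis (\<omega> * x)"
  have 1: "integrable lborel (\<lambda>\<omega>. f (0 + c * \<omega>))"
    using lborel_integrable_real_affine[OF int, of c 0] c by simp
  hence "integrable lborel (\<lambda>\<omega>. of_real (sqrt (2*pi)) * f (0 + c * \<omega>))" by (rule integrable_mult_right)
  moreover have eq: "(\<lambda>\<omega>. of_real (sqrt (2*pi)) * f (0 + c * \<omega>)) = ?g"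
    unfolding fc by (auto simp: field_simps)
  ultimately have gi: "integrable lborel ?g" by simp
  have "(LINT u|lborel. f u) = c *\<^sub>R (LINT \<omega>|lborel. f (0 + c * \<omega>))"
    using lborel_integral_real_affine[of c f 0] c by simp
  hence "(LINT \<omega>|lborel. f (0 + c * \<omega>)) = of_real (exp (- (y\<^sup>2) / 2)) / of_real c"
    using val c by (simp add: scaleR_conv_of_real field_simps)
  hence "(LINT \<omega>|lborel. ?g \<omega>) = of_real (sqrt (2*pi)) * (of_real (exp (- (y\<^sup>2) / 2)) / of_real c)"
    unfolding eq[symmetric] by simp
  also have "\<dots> = complex_of_real (sqrt (2*pi) * (exp (- (y\<^sup>2) / 2) / c))" by simp
  also have "sqrt (2*pi) * (exp (- (y\<^sup>2) / 2) / c) = sqrt (pi / t) * exp (- x\<^sup>2 / (4 * t))"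
  proof -
    have "y\<^sup>2 = x\<^sup>2 / (2 * t)" using c by (simp add: y_def power_divide)
    moreover have "sqrt (2*pi) / c = sqrt (pi / t)"
      using t by (simp add: c_def real_sqrt_divide[symmetric])
    moreover have "sqrt (2*pi) * (exp (- (y\<^sup>2) / 2) / c) = sqrt (2*pi) / c * exp (- (y\<^sup>2) / 2)"
      by simp
    ultimately show ?thesis by simp
  qed
  finally show ?thesis using gi by (simp add: has_bochner_integral_iff)
qed

text \<open>The Gaussian and the character \<open>exp (i \<omega>\<cdot>x)\<close> both factor over the coordinates, so the integral is
  a product of one-dimensional ones.\<close>

lemma gaussian_fourier:
  fixes x :: "'a::euclidean_space"
  assumes t: "t > 0"
  shows "has_bochner_integral lborel (\<lambda>\<omega>. exp (- t * (norm \<omega>)\<^sup>2) * cos (\<omega> \<bullet> x))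
           ((pi / t) powr (real DIM('a) / 2) * exp (- (norm x)\<^sup>2 / (4 * t)))"
proof -
  interpret product_sigma_finite "\<lambda>b::'a. lborel :: real measure" by standard
  let ?g = "\<lambda>b \<omega>. of_real (exp (- t * \<omega>\<^sup>2)) * cis (\<omega> * (x \<bullet> b))"
  let ?T = "\<lambda>f. \<Sum>b\<in>Basis. f b *\<^sub>R (b::'a)"
  let ?F = "\<lambda>\<omega>::'a. complex_of_real (exp (- t * (norm \<omega>)\<^sup>2)) * cis (\<omega> \<bullet> x)"
  have F: "?F (?T f) = (\<Prod>b\<in>Basis. ?g b (f b))" for f
  proof -
    have n: "(norm (?T f))\<^sup>2 = (\<Sum>b\<in>Basis. (f b)\<^sup>2)"
      by (subst power2_norm_eq_inner, subst euclidean_inner) (simp add: power2_eq_square)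
    have i: "?T f \<bullet> x = (\<Sum>b\<in>Basis. f b * (x \<bullet> b))"
      by (simp add: inner_sum_left inner_commute[of x])
    show ?thesis
      unfolding n i cis_conv_exp
      by (simp add: prod.distrib exp_sum[symmetric] sum_distrib_left sum_negf flip: exp_of_real)
  qed
  have gi: "integrable lborel (?g b)" and gv: "(LINT \<omega>|lborel. ?g b \<omega>) = of_real (sqrt (pi / t) * exp (- (x \<bullet> b)\<^sup>2 / (4 * t)))" for b
    using gaussian_fourier_real[OF t, of "x \<bullet> b"] by (auto simp: has_bochner_integral_iff)
  have T: "?T \<in> measurable (Pi\<^sub>M Basis (\<lambda>b. lborel)) borel" by measurable
  have Fm: "?F \<in> borel_measurable borel" unfolding cis_conv_exp by measurable
  have "integrable (Pi\<^sub>M Basis (\<lambda>b. lborel)) (\<lambda>f. \<Prod>b\<in>Basis. ?g b (f b))"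
    by (rule product_integrable_prod) (use gi in auto)
  hence int: "integrable lborel ?F"
    by (subst lborel_eq, subst integrable_distr_eq[OF T Fm]) (simp only: F)
  have "(LINT \<omega>|lborel. ?F \<omega>) = integral\<^sup>L (Pi\<^sub>M Basis (\<lambda>b. lborel)) (\<lambda>f. \<Prod>b\<in>Basis. ?g b (f b))"
    by (subst lborel_eq, subst integral_distr[OF T Fm]) (simp only: F)
  also have "\<dots> = (\<Prod>b\<in>Basis. (LINT \<omega>|lborel. ?g b \<omega>))"
    by (rule product_integral_prod) (use gi in auto)
  also have "\<dots> = of_real (\<Prod>b\<in>(Basis::'a set). (sqrt (pi / t) * exp (- (x \<bullet> b)\<^sup>2 / (4 * t))))"
    unfolding gv by simp
  also have "(\<Prod>b\<in>(Basis::'a set). (sqrt (pi / t) * exp (- (x \<bullet> b)\<^sup>2 / (4 * t))))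
     = (pi / t) powr (real DIM('a) / 2) * exp (- (norm x)\<^sup>2 / (4 * t))"
  proof -
    have "(norm x)\<^sup>2 = (\<Sum>b\<in>Basis. (x \<bullet> b)\<^sup>2)"
      by (subst power2_norm_eq_inner, subst euclidean_inner) (simp add: power2_eq_square)
    moreover have "sqrt (pi / t) ^ DIM('a) = (pi / t) powr (real DIM('a) / 2)"
      using t by (simp add: powr_half_sqrt[symmetric] powr_powr flip: powr_realpow)
    ultimately show ?thesis
      by (simp add: prod.distrib exp_sum[symmetric] sum_negf sum_divide_distrib)
  qed
  finally have val: "(LINT \<omega>|lborel. ?F \<omega>) = of_real ((pi / t) powr (real DIM('a) / 2) * exp (- (norm x)\<^sup>2 / (4 * t)))" .
  have "has_bochner_integral lborel ?F (of_real ((pi / t) powr (real DIM('a) / 2) * exp (- (norm x)\<^sup>2 / (4 * t))))"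
    using int val by (simp add: has_bochner_integral_iff)
  from has_bochner_integral_bounded_linear[OF bounded_linear_Re this]
  show ?thesis by simp
qed

section \<open>Gaussian energy of separated points\<close>

text \<open>A packing argument: the balls of radius \<open>1/2\<close> around the points are disjoint, and on each of them the
value of the Gaussian at the centre is at most a fixed multiple of a wider Gaussian.  Hence the sum is
bounded by the integral of the wider Gaussian divided by the volume of a ball.\<close>

lemma gaussian_sum_separated_bounded:
  obtains M where "M > 0"
    and "\<And>Y :: 'a::euclidean_space set. finite Y \<Longrightarrow> (\<And>y z. y \<in> Y \<Longrightarrow> z \<in> Y \<Longrightarrow> y \<noteq> z \<Longrightarrow> 1 \<le> norm (y - z)) \<Longrightarrow>
           (\<Sum>y\<in>Y. exp (- (norm y)\<^sup>2)) \<le> M"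
proof -
  define g where "g = (\<lambda>z::'a. exp (1/4) * exp (- (1/2) * (norm z)\<^sup>2))"
  have "integrable lborel (\<lambda>z::'a. exp (- (1/2) * (norm z)\<^sup>2))"
    using gaussian_fourier[of "1/2" "0::'a"] by (auto simp: has_bochner_integral_iff)
  hence gi: "integrable lborel g" unfolding g_def by (rule integrable_mult_right)
  define I where "I = (LINT z|lborel. g z)"
  have I0: "I \<ge> 0" unfolding I_def g_def by (intro Bochner_Integration.integral_nonneg) auto
  define V where "V = measure lborel (ball (0::'a) (1/2))"
  have V: "V > 0" unfolding V_def using content_ball_pos[of "1/2" "0::'a"] by simp
  \<comment> \<open>The summand \<open>1\<close> only makes positivity of the bound evident.\<close>
  have "(\<Sum>y\<in>Y. exp (- (norm y)\<^sup>2)) \<le> (I + 1) / V"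
    if fin: "finite Y" and sep: "\<And>y z. y \<in> Y \<Longrightarrow> z \<in> Y \<Longrightarrow> y \<noteq> z \<Longrightarrow> 1 \<le> norm (y - z)" for Y :: "'a set"
  proof -
    let ?B = "\<lambda>y::'a. ball y (1/2)"
    have ptw: "exp (- (norm y)\<^sup>2) \<le> g z" if "z \<in> ?B y" for y z :: 'a
    proof -
      have "norm z \<le> norm y + norm (z - y)" by (metis norm_triangle_sub)
      also have "\<dots> \<le> norm y + 1/2" using that by (simp add: dist_norm norm_minus_commute)
      finally have "(norm z)\<^sup>2 \<le> (norm y + 1/2)\<^sup>2" by (intro power_mono) auto
      also have "\<dots> \<le> 2 * (norm y)\<^sup>2 + 1/2"
        using zero_le_power2[of "norm y - 1/2"] by (simp add: power2_eq_square algebra_simps)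
      finally show ?thesis unfolding g_def by (simp add: exp_add[symmetric])
    qed
    have disj: "(\<Sum>y\<in>Y. indicator (?B y) z) \<le> (1::real)" for z :: 'a
    proof (cases "\<exists>y\<in>Y. z \<in> ?B y")
      case True
      then obtain y where y: "y \<in> Y" "z \<in> ?B y" by blast
      have "indicator (?B w) z = (0::real)" if "w \<in> Y - {y}" for w
      proof (rule ccontr)
        assume "indicator (?B w) z \<noteq> (0::real)"
        hence "z \<in> ?B w" by (auto simp: indicator_def split: if_splits)
        hence "dist y w < 1" using y dist_triangle_half_l[of y z 1 w] by (auto simp: dist_commute)
        thus False using sep[of y w] that y by (auto simp: dist_norm)
      qed
      hence "(\<Sum>w\<in>Y-{y}. indicator (?B w) z) = (0::real)" by (intro sum.neutral) auto
      thus ?thesis using sum.remove[OF fin y(1), of "\<lambda>w. indicator (?B w) z :: real"] y by simp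
    next
      case False
      hence "(\<Sum>y\<in>Y. indicator (?B y) z) = (0::real)" by (intro sum.neutral) auto
      thus ?thesis by simp
    qed
    have fin_ball: "emeasure lborel (ball y (1/2)) < \<infinity>" for y :: 'a
      by (rule emeasure_bounded_finite) (rule bounded_ball)
    have ii: "integrable lborel (\<lambda>z. exp (- (norm y)\<^sup>2) * indicator (?B y) z)" for y :: 'a
      by (intro integrable_mult_right integrable_real_indicator) (use fin_ball in simp_all)
    have "V * (\<Sum>y\<in>Y. exp (- (norm y)\<^sup>2)) = (\<Sum>y\<in>Y. LINT z|lborel. exp (- (norm y)\<^sup>2) * indicator (?B y) z)"
    proof -
      have "(LINT z|lborel. exp (- (norm y)\<^sup>2) * indicator (?B y) z) = exp (- (norm y)\<^sup>2) * V" for y :: 'a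
        by (simp add: V_def content_ball_conv_unit_ball[of "1/2"])
      thus ?thesis by (simp only: sum_distrib_left mult.commute)
    qed
    also have "\<dots> = (LINT z|lborel. (\<Sum>y\<in>Y. exp (- (norm y)\<^sup>2) * indicator (?B y) z))"
      using ii by (intro Bochner_Integration.integral_sum[symmetric]) auto
    also have "\<dots> \<le> (LINT z|lborel. g z)"
    proof (rule integral_mono)
      fix z :: 'a
      have "(\<Sum>y\<in>Y. exp (- (norm y)\<^sup>2) * indicator (?B y) z) \<le> (\<Sum>y\<in>Y. g z * indicator (?B y) z)"
        using ptw by (intro sum_mono) (auto simp: indicator_def)
      also have "\<dots> = g z * (\<Sum>y\<in>Y. indicator (?B y) z)" by (simp add: sum_distrib_left)
      also have "\<dots> \<le> g z * 1" using disj by (intro mult_left_mono) (auto simp: g_def)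
      finally show "(\<Sum>y\<in>Y. exp (- (norm y)\<^sup>2) * indicator (?B y) z) \<le> g z" by simp
    qed (use ii gi in auto)
    finally show ?thesis using V unfolding I_def by (simp add: field_simps)
  qed
  thus ?thesis using that[of "(I + 1) / V"] V I0 by (simp add: field_simps)
qed

text \<open>After scaling by \<open>q\<close>, the points other than \<open>x\<close> have norm at least \<open>1\<close> relative to \<open>x\<close>.  Sharpening the
Gaussian from exponent \<open>1\<close> to \<open>A\<close> therefore gains a factor \<open>exp (- (A - 1))\<close> in every term, and this
makes the bounded sum of the preceding lemma as small as desired.\<close>

lemma gaussian_row_sum_separated:
  obtains A where "A > 0"
    and "\<And>(X :: 'a::euclidean_space set) q a x. finite X \<Longrightarrow> q > 0 \<Longrightarrow>
           (\<And>y z. y \<in> X \<Longrightarrow> z \<in> X \<Longrightarrow> y \<noteq> z \<Longrightarrow> q \<le> norm (y - z)) \<Longrightarrow> A / q\<^sup>2 \<le> a \<Longrightarrow> x \<in> X \<Longrightarrow>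
           (\<Sum>z\<in>X-{x}. exp (- a * (norm (x - z))\<^sup>2)) \<le> 1/2"
proof -
  obtain M where M: "M > 0"
    and bd: "\<And>Y :: 'a set. finite Y \<Longrightarrow> (\<And>y z. y \<in> Y \<Longrightarrow> z \<in> Y \<Longrightarrow> y \<noteq> z \<Longrightarrow> 1 \<le> norm (y - z)) \<Longrightarrow>
           (\<Sum>y\<in>Y. exp (- (norm y)\<^sup>2)) \<le> M"
    by (rule gaussian_sum_separated_bounded) blast
  define A where "A = 1 + max 0 (ln (2 * M))"
  have A: "A \<ge> 1" by (simp add: A_def)
  have eA: "exp (- (A - 1)) * M \<le> 1/2"
  proof -
    have "2 * M = exp (ln (2 * M))" using M by simp
    also have "\<dots> \<le> exp (A - 1)" by (simp add: A_def)
    finally have "2 * M \<le> exp (A - 1)" .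
    hence "exp (- (A - 1)) * (2 * M) \<le> exp (- (A - 1)) * exp (A - 1)" by (intro mult_left_mono) auto
    thus ?thesis by (simp flip: exp_add)
  qed
  have "(\<Sum>z\<in>X-{x}. exp (- a * (norm (x - z))\<^sup>2)) \<le> 1/2"
    if fin: "finite X" and q: "q > 0"
      and sep: "\<And>y z. y \<in> X \<Longrightarrow> z \<in> X \<Longrightarrow> y \<noteq> z \<Longrightarrow> q \<le> norm (y - z)"
      and a: "A / q\<^sup>2 \<le> a" and x: "x \<in> X"
    for X :: "'a set" and q a x
  proof -
    define g where "g = (\<lambda>z. (1 / q) *\<^sub>R (x - z))"
    have inj: "inj_on g (X - {x})" using q by (auto simp: g_def inj_on_def)
    have ng: "norm (g y - g z) = norm (y - z) / q" for y z
    proof -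
      have "g y - g z = (1/q) *\<^sub>R (z - y)" by (simp add: g_def scaleR_diff_right[symmetric])
      thus ?thesis using q by (simp add: norm_minus_commute)
    qed
    have "(\<Sum>z\<in>X-{x}. exp (- a * (norm (x - z))\<^sup>2)) \<le> (\<Sum>z\<in>X-{x}. exp (- (A - 1)) * exp (- (norm (g z))\<^sup>2))"
    proof (rule sum_mono)
      fix z assume z: "z \<in> X - {x}"
      have g1: "norm (g z) = norm (x - z) / q" using q by (simp add: g_def)
      have "norm (g z) \<ge> 1" using sep[of x z] z x q by (auto simp: g1)
      hence "(norm (g z))\<^sup>2 \<ge> 1" by simp
      hence "A * (norm (g z))\<^sup>2 \<ge> (A - 1) + (norm (g z))\<^sup>2"
        using mult_left_mono[of 1 "(norm (g z))\<^sup>2" "A - 1"] A by (simp add: algebra_simps)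
      moreover have "a * (norm (x - z))\<^sup>2 \<ge> A * (norm (g z))\<^sup>2"
        using mult_right_mono[OF a, of "(norm (x - z))\<^sup>2"] by (simp add: g1 power_divide)
      ultimately show "exp (- a * (norm (x - z))\<^sup>2) \<le> exp (- (A - 1)) * exp (- (norm (g z))\<^sup>2)"
        by (simp add: exp_add[symmetric])
    qed
    also have "\<dots> = exp (- (A - 1)) * (\<Sum>y\<in>g ` (X - {x}). exp (- (norm y)\<^sup>2))"
      by (simp add: sum.reindex[OF inj] sum_distrib_left)
    also have "(\<Sum>y\<in>g ` (X - {x}). exp (- (norm y)\<^sup>2)) \<le> M"
    proof (rule bd)
      fix y z assume "y \<in> g ` (X - {x})" "z \<in> g ` (X - {x})" "y \<noteq> z"
      then obtain y' z' where "y' \<in> X" "z' \<in> X" "y' \<noteq> z'" "y = g y'" "z = g z'" by blast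
      thus "1 \<le> norm (y - z)" using sep[of y' z'] q by (simp add: ng)
    qed (use fin in simp)
    finally show ?thesis using eA by (auto simp: mult_left_mono)
  qed
  thus ?thesis using that[of A] A by auto
qed

text \<open>The off-diagonal part is estimated by \<open>\<bar>\<alpha> x \<alpha> z\<bar> \<le> ((\<alpha> x)\<^sup>2 + (\<alpha> z)\<^sup>2) / 2\<close>, where symmetry of \<open>K\<close> lets
the row bound be used for both squares.\<close>

lemma diagonally_dominant_quadratic_form:
  fixes K :: "'a \<Rightarrow> 'a \<Rightarrow> real"
  assumes X: "finite X"
    and sym: "\<And>x z. K x z = K z x" and nn: "\<And>x z. 0 \<le> K x z" and diag: "\<And>x. K x x = 1"
    and row: "\<And>x. x \<in> X \<Longrightarrow> (\<Sum>z\<in>X-{x}. K x z) \<le> 1/2"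
  shows "\<bar>(\<Sum>x\<in>X. \<Sum>z\<in>X. \<alpha> x * K x z * \<alpha> z) - (\<Sum>x\<in>X. (\<alpha> x)\<^sup>2)\<bar> \<le> 1/2 * (\<Sum>x\<in>X. (\<alpha> x)\<^sup>2)"
proof -
  define L where "L = (\<lambda>x z. if x = z then 0 else K x z)"
  have L: "L x z = L z x" "0 \<le> L x z" for x z using sym nn by (auto simp: L_def)
  have Lrow: "(\<Sum>z\<in>X. L x z) \<le> 1/2" if "x \<in> X" for x
  proof -
    have "(\<Sum>z\<in>X. L x z) = L x x + (\<Sum>z\<in>X-{x}. L x z)" using X that by (rule sum.remove)
    also have "\<dots> = (\<Sum>z\<in>X-{x}. K x z)"
    proof -
      have "(\<Sum>z\<in>X-{x}. L x z) = (\<Sum>z\<in>X-{x}. K x z)"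
        by (rule sum.cong) (auto simp: L_def)
      thus ?thesis by (simp add: L_def)
    qed
    finally show ?thesis using row[OF that] by simp
  qed
  have half: "(\<Sum>x\<in>X. \<Sum>z\<in>X. L x z * (\<alpha> x)\<^sup>2) \<le> 1/2 * (\<Sum>x\<in>X. (\<alpha> x)\<^sup>2)"
    unfolding sum_distrib_right[symmetric] sum_distrib_left
    by (intro sum_mono mult_right_mono Lrow) auto
  have "(\<Sum>z\<in>X. \<alpha> x * K x z * \<alpha> z) = (\<alpha> x)\<^sup>2 + (\<Sum>z\<in>X. \<alpha> x * L x z * \<alpha> z)" if "x \<in> X" for x
  proof -
    have "(\<Sum>z\<in>X. \<alpha> x * K x z * \<alpha> z) = \<alpha> x * K x x * \<alpha> x + (\<Sum>z\<in>X-{x}. \<alpha> x * K x z * \<alpha> z)"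
      using X that by (rule sum.remove)
    moreover have "(\<Sum>z\<in>X. \<alpha> x * L x z * \<alpha> z) = \<alpha> x * L x x * \<alpha> x + (\<Sum>z\<in>X-{x}. \<alpha> x * L x z * \<alpha> z)"
      using X that by (rule sum.remove)
    moreover have "(\<Sum>z\<in>X-{x}. \<alpha> x * L x z * \<alpha> z) = (\<Sum>z\<in>X-{x}. \<alpha> x * K x z * \<alpha> z)"
      by (rule sum.cong) (auto simp: L_def)
    ultimately show ?thesis by (simp add: diag L_def power2_eq_square)
  qed
  hence "\<bar>(\<Sum>x\<in>X. \<Sum>z\<in>X. \<alpha> x * K x z * \<alpha> z) - (\<Sum>x\<in>X. (\<alpha> x)\<^sup>2)\<bar> = \<bar>\<Sum>x\<in>X. \<Sum>z\<in>X. \<alpha> x * L x z * \<alpha> z\<bar>"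
    by (simp add: sum.distrib)
  also have "\<dots> \<le> (\<Sum>x\<in>X. \<Sum>z\<in>X. \<bar>\<alpha> x * L x z * \<alpha> z\<bar>)"
    by (intro order_trans[OF sum_abs] sum_mono sum_abs)
  also have "\<dots> \<le> (\<Sum>x\<in>X. \<Sum>z\<in>X. L x z * (\<alpha> x)\<^sup>2 / 2 + L x z * (\<alpha> z)\<^sup>2 / 2)"
  proof (intro sum_mono)
    fix x z
    have "\<bar>\<alpha> x\<bar> * \<bar>\<alpha> z\<bar> \<le> ((\<alpha> x)\<^sup>2 + (\<alpha> z)\<^sup>2) / 2"
      using zero_le_power2[of "\<bar>\<alpha> x\<bar> - \<bar>\<alpha> z\<bar>"] by (simp add: power2_diff)
    from mult_left_mono[OF this L(2)[of x z]]
    show "\<bar>\<alpha> x * L x z * \<alpha> z\<bar> \<le> L x z * (\<alpha> x)\<^sup>2 / 2 + L x z * (\<alpha> z)\<^sup>2 / 2"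
      using L(2)[of x z] by (simp add: abs_mult algebra_simps add_divide_distrib)
  qed
  also have "\<dots> = (\<Sum>x\<in>X. \<Sum>z\<in>X. L x z * (\<alpha> x)\<^sup>2) / 2 + (\<Sum>x\<in>X. \<Sum>z\<in>X. L x z * (\<alpha> z)\<^sup>2) / 2"
    by (simp add: sum.distrib sum_divide_distrib)
  also have "(\<Sum>x\<in>X. \<Sum>z\<in>X. L x z * (\<alpha> z)\<^sup>2) = (\<Sum>x\<in>X. \<Sum>z\<in>X. L x z * (\<alpha> x)\<^sup>2)"
    by (subst sum.swap) (simp add: L(1))
  finally show ?thesis using half by simp
qed

text \<open>This two-sided estimate is where the separation of the points enters: at scales \<open>t\<close> below a fixed
multiple of \<open>q\<^sup>2\<close> the exponentials \<open>exp (i \<omega>\<cdot>x)\<close> behave like an orthogonal system for the Gaussian weight.\<close>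

lemma gaussian_trig_energy_bounds:
  obtains A where "A > 0"
    and "\<And>(X :: 'a::euclidean_space set) \<alpha> q t. finite X \<Longrightarrow> q > 0 \<Longrightarrow>
           (\<And>y z. y \<in> X \<Longrightarrow> z \<in> X \<Longrightarrow> y \<noteq> z \<Longrightarrow> q \<le> norm (y - z)) \<Longrightarrow> 0 < t \<Longrightarrow> t \<le> A * q\<^sup>2 \<Longrightarrow>
           \<exists>I. has_bochner_integral lborel (\<lambda>\<omega>. exp (- t * (norm \<omega>)\<^sup>2) * trig_energy \<alpha> X \<omega>) I \<and>
             1/2 * (\<Sum>x\<in>X. (\<alpha> x)\<^sup>2) * (pi / t) powr (real DIM('a) / 2) \<le> I \<and>
             I \<le> 3/2 * (\<Sum>x\<in>X. (\<alpha> x)\<^sup>2) * (pi / t) powr (real DIM('a) / 2)"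
proof -
  obtain A where A: "A > 0"
    and row: "\<And>(X :: 'a::euclidean_space set) q a x. finite X \<Longrightarrow> q > 0 \<Longrightarrow>
           (\<And>y z. y \<in> X \<Longrightarrow> z \<in> X \<Longrightarrow> y \<noteq> z \<Longrightarrow> q \<le> norm (y - z)) \<Longrightarrow> A / q\<^sup>2 \<le> a \<Longrightarrow> x \<in> X \<Longrightarrow>
           (\<Sum>z\<in>X-{x}. exp (- a * (norm (x - z))\<^sup>2)) \<le> 1/2"
    by (rule gaussian_row_sum_separated) blast
  have "\<exists>I. has_bochner_integral lborel (\<lambda>\<omega>. exp (- t * (norm \<omega>)\<^sup>2) * trig_energy \<alpha> X \<omega>) I \<and>
             1/2 * (\<Sum>x\<in>X. (\<alpha> x)\<^sup>2) * (pi / t) powr (real DIM('a) / 2) \<le> I \<and>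
             I \<le> 3/2 * (\<Sum>x\<in>X. (\<alpha> x)\<^sup>2) * (pi / t) powr (real DIM('a) / 2)"
    if X: "finite X" "q > 0" "\<And>y z. y \<in> X \<Longrightarrow> z \<in> X \<Longrightarrow> y \<noteq> z \<Longrightarrow> q \<le> norm (y - z)"
      and t: "0 < t" "t \<le> 1 / (4 * A) * q\<^sup>2" for X :: "'a set" and \<alpha> q t
  proof -
    define K where "K = (\<lambda>x z :: 'a. exp (- (1 / (4 * t)) * (norm (x - z))\<^sup>2))"
    define G where "G = (\<Sum>x\<in>X. \<Sum>z\<in>X. \<alpha> x * K x z * \<alpha> z)"
    define S where "S = (\<Sum>x\<in>X. (\<alpha> x)\<^sup>2)"
    define p where "p = (pi / t) powr (real DIM('a) / 2)"
    have p: "p \<ge> 0" by (simp add: p_def)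
    have "A / q\<^sup>2 \<le> 1 / (4 * t)" using t A X(2) by (simp add: field_simps)
    hence "(\<Sum>z\<in>X-{x}. K x z) \<le> 1/2" if "x \<in> X" for x
      unfolding K_def using row[OF X _ that] by blast
    hence "\<bar>G - S\<bar> \<le> 1/2 * S" unfolding G_def S_def
      by (intro diagonally_dominant_quadratic_form X(1)) (auto simp: K_def norm_minus_commute)
    hence G: "1/2 * S \<le> G" "G \<le> 3/2 * S" unfolding abs_le_iff by linarith+
    have "has_bochner_integral lborel (\<lambda>\<omega>. exp (- t * (norm \<omega>)\<^sup>2) * trig_energy \<alpha> X \<omega>)
      (\<Sum>x\<in>X. \<Sum>z\<in>X. \<alpha> x * (p * exp (- (norm (x - z))\<^sup>2 / (4 * t))) * \<alpha> z)"
      unfolding p_def by (rule integral_weighted_trig_energy) (rule gaussian_fourier[OF t(1)])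
    also have "(\<Sum>x\<in>X. \<Sum>z\<in>X. \<alpha> x * (p * exp (- (norm (x - z))\<^sup>2 / (4 * t))) * \<alpha> z) = p * G"
      by (simp add: G_def K_def sum_distrib_left mult_ac)
    finally have "has_bochner_integral lborel (\<lambda>\<omega>. exp (- t * (norm \<omega>)\<^sup>2) * trig_energy \<alpha> X \<omega>) (p * G)" .
    moreover have "1/2 * S * p \<le> p * G" "p * G \<le> 3/2 * S * p"
      using mult_left_mono[OF G(1) p] mult_left_mono[OF G(2) p] by (simp_all add: mult_ac)
    ultimately show ?thesis unfolding S_def p_def by blast
  qed
  thus ?thesis using that[of "1 / (4 * A)"] A by auto
qed

section \<open>Bessel weights and Gaussians\<close>

text \<open>With \<open>v = t (1 + u)\<close> this is the inequality \<open>v powr \<tau> \<le> \<tau> powr \<tau> * exp v\<close>, which is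
\<open>v / \<tau> \<le> exp (v / \<tau>)\<close> raised to the power \<open>\<tau>\<close>.\<close>

lemma bessel_weight_ge_gaussian:
  fixes u t \<tau> :: real
  assumes "0 \<le> u" "0 < t" "0 < \<tau>"
  shows "exp (- t * u) \<le> exp t * \<tau> powr \<tau> * t powr (- \<tau>) * (1 + u) powr (- \<tau>)"
proof -
  define v where "v = t * (1 + u)"
  have v: "v > 0" using assms by (simp add: v_def)
  have "v / \<tau> \<le> exp (v / \<tau>)" using exp_ge_add_one_self[of "v / \<tau>"] by linarith
  hence "(v / \<tau>) powr \<tau> \<le> exp (v / \<tau>) powr \<tau>" using v assms by (intro powr_mono2) auto
  hence "v powr \<tau> \<le> \<tau> powr \<tau> * exp v"
    using v assms by (simp add: powr_divide field_simps exp_powr_real)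
  hence "1 \<le> \<tau> powr \<tau> * exp v * v powr (- \<tau>)" using v by (simp add: powr_minus field_simps)
  hence "exp (- t * u) \<le> exp (- t * u) * (\<tau> powr \<tau> * exp v * v powr (- \<tau>))" by simp
  also have "\<dots> = exp t * \<tau> powr \<tau> * t powr (- \<tau>) * (1 + u) powr (- \<tau>)"
  proof -
    have "exp (- t * u) * exp v = exp t" by (simp add: v_def algebra_simps flip: exp_add)
    moreover have "v powr (- \<tau>) = t powr (- \<tau>) * (1 + u) powr (- \<tau>)"
      using assms by (simp add: v_def powr_mult)
    ultimately show ?thesis by (metis mult.assoc mult.commute)
  qed
  finally show ?thesis .
qed

text \<open>Here \<open>u\<close> stands for \<open>\<bar>\<omega>\<bar>\<^sup>2\<close>.  Low frequencies \<open>u \<le> 1 / t\<close> fall under the first alternative.  Otherwise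
\<open>4 ^ k \<le> u t < 4 ^ (k + 1)\<close> for some \<open>k\<close>; then the weight is at most \<open>(t / 4 ^ k) powr s\<close>, while the
Gaussian with parameter \<open>t / 4 ^ k\<close> is still at least \<open>exp (- 4)\<close>.\<close>

lemma bessel_weight_le_low_plus_gaussians:
  fixes u t \<tau> s :: real
  assumes "0 \<le> u" "0 < t" "0 < s" "s \<le> \<tau>"
  shows "(1 + u) powr (- s) \<le> (1 + 1 / t) powr (\<tau> - s) * (1 + u) powr (- \<tau>) \<or>
         (\<exists>k::nat. (1 + u) powr (- s) \<le> exp 4 * (t / 4 ^ k) powr s * exp (- (t / 4 ^ k) * u))"
proof (cases "u \<le> 1 / t")
  case True
  have "(1 + u) powr (- s) = (1 + u) powr (\<tau> - s) * (1 + u) powr (- \<tau>)"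
    by (simp add: powr_add[symmetric])
  also have "\<dots> \<le> (1 + 1 / t) powr (\<tau> - s) * (1 + u) powr (- \<tau>)"
    using True assms by (intro mult_right_mono powr_mono2) auto
  finally show ?thesis by blast
next
  case False
  hence "u > 0" using assms less_trans[of 0 "1 / t" u] by simp
  hence ut: "u * t > 1" "u > 0" using False assms by (auto simp: field_simps)
  define k where "k = nat \<lfloor>log 4 (u * t)\<rfloor>"
  have k0: "\<lfloor>log 4 (u * t)\<rfloor> \<ge> 0" using ut by simp
  hence kk: "real k \<le> log 4 (u * t)" "log 4 (u * t) < real k + 1" unfolding k_def by linarith+
  have lo: "4 ^ k \<le> u * t" using kk(1) ut by (simp add: le_log_iff powr_realpow)
  have "u * t < 4 powr (real k + 1)" using kk(2) ut by (simp add: log_less_iff)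
  hence hi: "u * t < 4 * 4 ^ k" by (simp add: powr_add powr_realpow)
  have "(1 + u) powr (- s) \<le> (4 ^ k / t) powr (- s)"
    using lo assms by (intro powr_mono2') (auto simp: field_simps)
  also have "\<dots> = (t / 4 ^ k) powr s"
    using assms by (simp add: powr_minus powr_divide)
  also have "\<dots> \<le> (t / 4 ^ k) powr s * exp (4 - (t / 4 ^ k) * u)"
  proof -
    have "(t / 4 ^ k) * u \<le> 4" using hi by (simp add: field_simps)
    hence "1 \<le> exp (4 - (t / 4 ^ k) * u)" by simp
    from mult_left_mono[OF this, of "(t / 4 ^ k) powr s"] show ?thesis by simp
  qed
  also have "\<dots> = exp 4 * (t / 4 ^ k) powr s * exp (- (t / 4 ^ k) * u)"
    unfolding diff_conv_add_uminus exp_add by simp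
  finally show ?thesis by blast
qed

text \<open>The heart of the upper bound, for any density \<open>P\<close> whose Gaussian integrals behave at all scales
\<open>r \<le> t\<close> like those of a constant density of height \<open>S\<close>.  The scale \<open>r = t\<close> alone bounds \<open>S\<close> by \<open>J\<close>;
the scales \<open>t / 4 ^ k\<close> bound the high frequency part of \<open>Js\<close> by \<open>S\<close>.\<close>

lemma bessel_weighted_integral_comparison:
  fixes P :: "'a::euclidean_space \<Rightarrow> real"
  assumes s: "real DIM('a) / 2 < s" "s \<le> \<tau>" and t: "0 < t"
    and P: "\<And>\<omega>. 0 \<le> P \<omega>"
    and J: "has_bochner_integral lborel (\<lambda>\<omega>. (1 + (norm \<omega>)\<^sup>2) powr (- \<tau>) * P \<omega>) J"
    and Js: "has_bochner_integral lborel (\<lambda>\<omega>. (1 + (norm \<omega>)\<^sup>2) powr (- s) * P \<omega>) Js"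
    and gauss: "\<And>r. 0 < r \<Longrightarrow> r \<le> t \<Longrightarrow>
       \<exists>I. has_bochner_integral lborel (\<lambda>\<omega>. exp (- r * (norm \<omega>)\<^sup>2) * P \<omega>) I \<and>
             1/2 * S * (pi / r) powr (real DIM('a) / 2) \<le> I \<and>
             I \<le> 3/2 * S * (pi / r) powr (real DIM('a) / 2)"
  shows "Js \<le> ((1 + t) powr (\<tau> - s) + 3 * exp (4 + t) * \<tau> powr \<tau> / (1 - 4 powr (- (s - real DIM('a) / 2))))
            * t powr (- (\<tau> - s)) * J"
proof -
  define h where "h = real DIM('a) / 2"
  define \<rho> where "\<rho> = 4 powr (- (s - h))"
  have h: "0 < h" "h < s" using s by (auto simp: h_def)
  have \<tau>: "0 < \<tau>" "0 < s" using h s by auto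
  have \<rho>: "0 < \<rho>" "\<rho> < 1" using h unfolding \<rho>_def by (auto intro!: powr_less_one)
  have J0: "J \<ge> 0"
  proof -
    have "J = (LINT \<omega>|lborel. (1 + (norm \<omega>)\<^sup>2) powr (- \<tau>) * P \<omega>)"
      using J by (simp add: has_bochner_integral_iff)
    also have "\<dots> \<ge> 0" using P by (intro Bochner_Integration.integral_nonneg) auto
    finally show ?thesis .
  qed
  \<comment> \<open>The lower bound at scale \<open>t\<close> gives an estimate of \<open>S\<close> in terms of \<open>J\<close>.\<close>
  obtain I where I: "has_bochner_integral lborel (\<lambda>\<omega>. exp (- t * (norm \<omega>)\<^sup>2) * P \<omega>) I"
    "1/2 * S * (pi / t) powr h \<le> I" "I \<le> 3/2 * S * (pi / t) powr h"
    using gauss[of t] t unfolding h_def by auto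
  have ph: "(pi / t) powr h > 0" using t by simp
  have S0: "S \<ge> 0"
  proof (rule ccontr)
    assume "\<not> S \<ge> 0"
    hence "S * (pi / t) powr h < 0" using ph by (simp add: mult_neg_pos)
    thus False using I by linarith
  qed
  have IJ: "I \<le> exp t * \<tau> powr \<tau> * t powr (- \<tau>) * J"
  proof -
    have "has_bochner_integral lborel (\<lambda>\<omega>. exp t * \<tau> powr \<tau> * t powr (- \<tau>) * ((1 + (norm \<omega>)\<^sup>2) powr (- \<tau>) * P \<omega>))
       (exp t * \<tau> powr \<tau> * t powr (- \<tau>) * J)"
      by (rule has_bochner_integral_mult_right) (rule J)
    moreover have "exp (- t * (norm \<omega>)\<^sup>2) * P \<omega>
        \<le> exp t * \<tau> powr \<tau> * t powr (- \<tau>) * ((1 + (norm \<omega>)\<^sup>2) powr (- \<tau>) * P \<omega>)" for \<omega>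
      using mult_right_mono[OF bessel_weight_ge_gaussian[OF _ t \<tau>(1), of "(norm \<omega>)\<^sup>2"] P[of \<omega>]]
      by (simp add: mult_ac)
    ultimately show ?thesis by (rule has_bochner_integral_mono[OF I(1)])
  qed
  have SJ: "S * pi powr h \<le> 2 * exp t * \<tau> powr \<tau> * t powr (h - \<tau>) * J"
  proof -
    have "S * pi powr h = 2 * t powr h * (1/2 * S * (pi / t) powr h)"
      using t by (simp add: powr_divide)
    also have "\<dots> \<le> 2 * t powr h * (exp t * \<tau> powr \<tau> * t powr (- \<tau>) * J)"
      using I(2) IJ by (intro mult_left_mono) auto
    also have "\<dots> = 2 * exp t * \<tau> powr \<tau> * t powr (h - \<tau>) * J"
      by (simp add: powr_diff powr_minus field_simps)
    finally show ?thesis .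
  qed
  \<comment> \<open>The integrand of \<open>Js\<close> is dominated by \<open>F + (\<Sum>k. G k)\<close>, with \<open>F\<close> the low frequency part.
      The integrals of the \<open>G k\<close> decay like \<open>\<rho> ^ k\<close>, because the Gaussian integral grows like
      \<open>(4 ^ k) powr h\<close> and its coefficient \<open>b k\<close> decays like \<open>(4 ^ k) powr (- s)\<close>.  Working in the
      extended nonnegative reals makes the exchange of sum and integral unconditional.\<close>
  define b where "b = (\<lambda>k::nat. exp 4 * (t / 4 ^ k) powr s)"
  define G where "G = (\<lambda>k::nat. \<lambda>\<omega>. b k * (exp (- (t / 4 ^ k) * (norm \<omega>)\<^sup>2) * P \<omega>))"
  define A where "A = (1 + 1 / t) powr (\<tau> - s)"
  define F where "F = (\<lambda>\<omega>. A * ((1 + (norm \<omega>)\<^sup>2) powr (- \<tau>) * P \<omega>))"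
  define M where "M = 3/2 * exp 4 * S * pi powr h * t powr (s - h)"
  have M0: "M \<ge> 0" using S0 by (simp add: M_def)
  have G0: "G k \<omega> \<ge> 0" for k \<omega> using P by (simp add: G_def b_def)
  have F0: "F \<omega> \<ge> 0" for \<omega> using P by (simp add: F_def A_def)
  have Gm: "G k \<in> borel_measurable lborel" and nG: "(\<integral>\<^sup>+\<omega>. ennreal (G k \<omega>) \<partial>lborel) \<le> ennreal (M * \<rho> ^ k)" for k
  proof -
    let ?r = "t / 4 ^ k"
    have r: "?r > 0" "?r \<le> t" using t by (auto simp: field_simps)
    obtain Ik where Ik: "has_bochner_integral lborel (\<lambda>\<omega>. exp (- ?r * (norm \<omega>)\<^sup>2) * P \<omega>) Ik"
      "Ik \<le> 3/2 * S * (pi / ?r) powr h"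
      using gauss[OF r] unfolding h_def by blast
    have hG: "has_bochner_integral lborel (G k) (b k * Ik)"
      unfolding G_def by (rule has_bochner_integral_mult_right) (rule Ik)
    show "G k \<in> borel_measurable lborel"
      using hG by (auto simp: has_bochner_integral_iff)
    have "(\<integral>\<^sup>+\<omega>. ennreal (G k \<omega>) \<partial>lborel) = ennreal (b k * Ik)"
      using hG G0 by (subst nn_integral_eq_integral) (auto simp: has_bochner_integral_iff)
    also have "b k * Ik \<le> b k * (3/2 * S * (pi / ?r) powr h)"
      using Ik(2) by (intro mult_left_mono) (auto simp: b_def)
    also have "\<dots> = 3/2 * exp 4 * S * pi powr h * ?r powr (s - h)"
    proof -
      have "exp 4 * r powr s * (3/2 * S * (pi / r) powr h) = 3/2 * exp 4 * S * pi powr h * r powr (s - h)"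
        if "r > 0" for r using that by (simp add: powr_divide powr_diff)
      from this[OF r(1)] show ?thesis by (simp only: b_def)
    qed
    also have "?r powr (s - h) = t powr (s - h) * \<rho> ^ k"
    proof -
      have "(4 ^ k) powr (s - h) = (4 powr (s - h)) ^ k"
        by (simp add: powr_realpow[symmetric] powr_powr mult.commute)
      moreover have "\<rho> = inverse (4 powr (s - h))" by (simp only: \<rho>_def powr_minus)
      moreover have "?r powr (s - h) = t powr (s - h) * inverse ((4 ^ k) powr (s - h))"
        using t by (simp add: powr_divide divide_inverse[of "t powr (s - h)"])
      ultimately show ?thesis by (simp add: power_inverse)
    qed
    finally show "(\<integral>\<^sup>+\<omega>. ennreal (G k \<omega>) \<partial>lborel) \<le> ennreal (M * \<rho> ^ k)"
      by (simp add: M_def mult_ac ennreal_leI)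
  qed
  have hF: "has_bochner_integral lborel F (A * J)"
    unfolding F_def by (rule has_bochner_integral_mult_right) (rule J)
  have Fm: "F \<in> borel_measurable lborel" using hF by (auto simp: has_bochner_integral_iff)
  have nF: "(\<integral>\<^sup>+\<omega>. ennreal (F \<omega>) \<partial>lborel) = ennreal (A * J)"
    using hF F0 by (subst nn_integral_eq_integral) (auto simp: has_bochner_integral_iff)
  have "ennreal Js = (\<integral>\<^sup>+\<omega>. ennreal ((1 + (norm \<omega>)\<^sup>2) powr (- s) * P \<omega>) \<partial>lborel)"
    using Js P by (subst nn_integral_eq_integral) (auto simp: has_bochner_integral_iff)
  also have "\<dots> \<le> (\<integral>\<^sup>+\<omega>. ennreal (F \<omega>) + (\<Sum>k. ennreal (G k \<omega>)) \<partial>lborel)"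
  proof (rule nn_integral_mono)
    fix \<omega> :: 'a
    let ?w = "(1 + (norm \<omega>)\<^sup>2) powr (- s)"
    from bessel_weight_le_low_plus_gaussians[of "(norm \<omega>)\<^sup>2" t s \<tau>]
    consider "?w \<le> A * (1 + (norm \<omega>)\<^sup>2) powr (- \<tau>)"
      | k where "?w \<le> b k * exp (- (t / 4 ^ k) * (norm \<omega>)\<^sup>2)"
      unfolding A_def b_def using t \<tau> s by (auto simp: mult_ac)
    thus "ennreal (?w * P \<omega>) \<le> ennreal (F \<omega>) + (\<Sum>k. ennreal (G k \<omega>))"
    proof cases
      case 1
      hence "?w * P \<omega> \<le> F \<omega>" using mult_right_mono[OF 1 P[of \<omega>]] by (simp add: F_def mult_ac)
      thus ?thesis by (intro add_increasing2) (auto intro: ennreal_leI)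
    next
      case 2
      hence "?w * P \<omega> \<le> G k \<omega>" using mult_right_mono[OF 2 P[of \<omega>]] by (simp add: G_def mult_ac)
      hence "ennreal (?w * P \<omega>) \<le> (\<Sum>k\<in>{k}. ennreal (G k \<omega>))" by (auto intro: ennreal_leI)
      also have "\<dots> \<le> (\<Sum>k. ennreal (G k \<omega>))" by (rule sum_le_suminf) auto
      finally show ?thesis by (intro add_increasing) auto
    qed
  qed
  also have "\<dots> = (\<integral>\<^sup>+\<omega>. ennreal (F \<omega>) \<partial>lborel) + (\<Sum>k. \<integral>\<^sup>+\<omega>. ennreal (G k \<omega>) \<partial>lborel)"
    using Fm Gm by (subst nn_integral_add) (auto simp: nn_integral_suminf)
  also have "\<dots> \<le> ennreal (A * J) + (\<Sum>k. ennreal (M * \<rho> ^ k))"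
    unfolding nF by (intro add_left_mono suminf_le nG) auto
  also have "(\<Sum>k. ennreal (M * \<rho> ^ k)) = ennreal (M * (1 / (1 - \<rho>)))"
    using \<rho> M0 by (intro suminf_ennreal_eq sums_mult geometric_sums) auto
  also have "ennreal (A * J) + ennreal (M * (1 / (1 - \<rho>))) = ennreal (A * J + M / (1 - \<rho>))"
    using M0 \<rho> J0 by (subst ennreal_plus) (auto simp: A_def)
  finally have "Js \<le> A * J + M / (1 - \<rho>)"
    using M0 \<rho> J0 by (subst (asm) ennreal_le_iff) (auto simp: A_def)
  also have "M / (1 - \<rho>) \<le> (3 * exp (4 + t) * \<tau> powr \<tau> / (1 - \<rho>)) * t powr (- (\<tau> - s)) * J"
  proof -
    have "M = 3/2 * exp 4 * t powr (s - h) * (S * pi powr h)" by (simp add: M_def)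
    also have "\<dots> \<le> 3/2 * exp 4 * t powr (s - h) * (2 * exp t * \<tau> powr \<tau> * t powr (h - \<tau>) * J)"
      using SJ by (intro mult_left_mono) auto
    also have "\<dots> = 3 * exp (4 + t) * \<tau> powr \<tau> * (t powr (s - h) * t powr (h - \<tau>)) * J"
      by (simp add: exp_add)
    also have "t powr (s - h) * t powr (h - \<tau>) = t powr (- (\<tau> - s))"
      by (simp add: powr_add[symmetric])
    finally show ?thesis using \<rho> by (simp add: divide_right_mono)
  qed
  also have "A = (1 + t) powr (\<tau> - s) * t powr (- (\<tau> - s))"
  proof -
    have "1 + 1 / t = (1 + t) / t" using t by (simp add: field_simps)
    thus ?thesis using t unfolding A_def powr_minus by (simp add: powr_divide divide_inverse[of "(1 + t) powr (\<tau> - s)"])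
  qed
  finally show ?thesis by (simp add: \<rho>_def h_def algebra_simps)
qed

section \<open>Comparison of the Rayleigh quotients\<close>

lemma separation_distance_props:
  fixes X :: "'a::real_normed_vector set"
  assumes "finite X" "card X \<ge> 2"
  shows "separation_distance X > 0"
    and "\<And>x z. x \<in> X \<Longrightarrow> z \<in> X \<Longrightarrow> x \<noteq> z \<Longrightarrow> separation_distance X \<le> norm (x - z)"
    and "\<exists>x\<in>X. \<exists>z\<in>X. separation_distance X = norm (x - z)"
proof -
  let ?D = "{norm (x - z) | x z. x \<in> X \<and> z \<in> X \<and> x \<noteq> z}"
  have "?D \<subseteq> (\<lambda>(x, z). norm (x - z)) ` (X \<times> X)" by auto
  hence fin: "finite ?D" using assms(1) by (meson finite_SigmaI finite_imageI finite_subset)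
  have "\<exists>x\<in>X. \<exists>z\<in>X. x \<noteq> z" using assms card_le_Suc0_iff_eq[of X] by auto
  hence "?D \<noteq> {}" by blast
  with fin have "separation_distance X \<in> ?D" unfolding separation_distance_def by (rule Min_in)
  thus "separation_distance X > 0" "\<exists>x\<in>X. \<exists>z\<in>X. separation_distance X = norm (x - z)" by auto
  show "separation_distance X \<le> norm (x - z)" if "x \<in> X" "z \<in> X" "x \<noteq> z" for x z
    unfolding separation_distance_def using fin that by (intro Min_le) auto
qed

text \<open>The scale is \<open>t = A q\<^sup>2\<close>, the largest one that the Gaussian energy estimates cover.  The points lie in
a ball of radius \<open>D\<close>, so \<open>q \<le> 2 D\<close>, and the factor \<open>K t\<close> can be replaced by its value at the largest
possible scale, which does not depend on \<open>X\<close>.\<close>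

lemma bessel_kernel_rayleigh_quotient_comparison:
  fixes \<Omega> :: "(real^'d) set"
  assumes "bounded \<Omega>" and s: "real CARD('d) / 2 < s" "s \<le> \<tau>"
  obtains c where "c > 0"
    and "\<And>(\<Phi> :: real^'d \<Rightarrow> real) \<Phi>s X \<alpha>.
      fourier_pair \<Phi> (\<lambda>\<omega>. (1 + (norm \<omega>)\<^sup>2) powr (- \<tau>)) \<Longrightarrow>
      fourier_pair \<Phi>s (\<lambda>\<omega>. (1 + (norm \<omega>)\<^sup>2) powr (- s)) \<Longrightarrow>
      finite X \<Longrightarrow> X \<subseteq> \<Omega> \<Longrightarrow> card X \<ge> 2 \<Longrightarrow>
      kernel_rayleigh_quotient (\<lambda>x z. \<Phi>s (x - z)) X \<alpha>
        \<le> c * separation_distance X powr (- (2 * (\<tau> - s))) * kernel_rayleigh_quotient (\<lambda>x z. \<Phi> (x - z)) X \<alpha>"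
proof -
  obtain A where A: "A > 0"
    and gauss: "\<And>(X :: (real^'d) set) \<alpha> q t. finite X \<Longrightarrow> q > 0 \<Longrightarrow>
           (\<And>y z. y \<in> X \<Longrightarrow> z \<in> X \<Longrightarrow> y \<noteq> z \<Longrightarrow> q \<le> norm (y - z)) \<Longrightarrow> 0 < t \<Longrightarrow> t \<le> A * q\<^sup>2 \<Longrightarrow>
           \<exists>I. has_bochner_integral lborel (\<lambda>\<omega>. exp (- t * (norm \<omega>)\<^sup>2) * trig_energy \<alpha> X \<omega>) I \<and>
             1/2 * (\<Sum>x\<in>X. (\<alpha> x)\<^sup>2) * (pi / t) powr (real DIM(real^'d) / 2) \<le> I \<and>
             I \<le> 3/2 * (\<Sum>x\<in>X. (\<alpha> x)\<^sup>2) * (pi / t) powr (real DIM(real^'d) / 2)"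
    by (rule gaussian_trig_energy_bounds) blast
  obtain D where D: "D > 0" "\<And>x. x \<in> \<Omega> \<Longrightarrow> norm x \<le> D"
    using assms(1) unfolding bounded_pos by blast
  define \<rho> where "\<rho> = 4 powr (- (s - real DIM(real^'d) / 2))"
  have \<rho>: "\<rho> < 1" using s unfolding \<rho>_def by (auto intro!: powr_less_one)
  define K where "K = (\<lambda>t. (1 + t) powr (\<tau> - s) + 3 * exp (4 + t) * \<tau> powr \<tau> / (1 - \<rho>))"
  define c where "c = K (A * (2 * D)\<^sup>2) * A powr (- (\<tau> - s))"
  have Kpos: "K t > 0" if "t > 0" for t
    unfolding K_def using that \<rho> by (intro add_pos_nonneg) auto
  have c: "c > 0" unfolding c_def using A D Kpos by simp
  have "kernel_rayleigh_quotient (\<lambda>x z. \<Phi>s (x - z)) X \<alpha>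
        \<le> c * separation_distance X powr (- (2 * (\<tau> - s))) * kernel_rayleigh_quotient (\<lambda>x z. \<Phi> (x - z)) X \<alpha>"
    if pair: "fourier_pair \<Phi> (\<lambda>\<omega>. (1 + (norm \<omega>)\<^sup>2) powr (- \<tau>))"
       "fourier_pair \<Phi>s (\<lambda>\<omega>. (1 + (norm \<omega>)\<^sup>2) powr (- s))"
      and X: "finite X" "X \<subseteq> \<Omega>" "card X \<ge> 2"
    for \<Phi> \<Phi>s :: "real^'d \<Rightarrow> real" and X \<alpha>
  proof -
    define q where "q = separation_distance X"
    define t where "t = A * q\<^sup>2"
    define N where "N = (2 * pi) powr (real CARD('d) / 2)"
    define J where "J = (\<Sum>x\<in>X. \<Sum>z\<in>X. \<alpha> x * \<Phi> (x - z) * \<alpha> z)"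
    define Js where "Js = (\<Sum>x\<in>X. \<Sum>z\<in>X. \<alpha> x * \<Phi>s (x - z) * \<alpha> z)"
    have N: "N > 0" by (simp add: N_def)
    have q: "q > 0" and sep: "\<And>y z. y \<in> X \<Longrightarrow> z \<in> X \<Longrightarrow> y \<noteq> z \<Longrightarrow> q \<le> norm (y - z)"
      using separation_distance_props[OF X(1,3)] by (auto simp: q_def)
    have qD: "q \<le> 2 * D"
    proof -
      obtain x z where xz: "x \<in> X" "z \<in> X" "q = norm (x - z)"
        using separation_distance_props(3)[OF X(1,3)] unfolding q_def by blast
      have "norm (x - z) \<le> norm x + norm z" by (rule norm_triangle_ineq4)
      also have "\<dots> \<le> D + D" using D(2) xz X(2) by (intro add_mono) auto
      finally show ?thesis using xz by simp
    qed
    have t: "t > 0" using A q by (simp add: t_def)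
    have tT: "t \<le> A * (2 * D)\<^sup>2"
      unfolding t_def using A q qD by (intro mult_left_mono power_mono) auto
    have J: "has_bochner_integral lborel (\<lambda>\<omega>. (1 + (norm \<omega>)\<^sup>2) powr (- \<tau>) * trig_energy \<alpha> X \<omega>) (N * J)"
      unfolding N_def J_def by (rule fourier_pair_quadratic_form) (rule pair)
    have Js: "has_bochner_integral lborel (\<lambda>\<omega>. (1 + (norm \<omega>)\<^sup>2) powr (- s) * trig_energy \<alpha> X \<omega>) (N * Js)"
      unfolding N_def Js_def by (rule fourier_pair_quadratic_form) (rule pair)
    have "N * J = (LINT \<omega>|lborel. (1 + (norm \<omega>)\<^sup>2) powr (- \<tau>) * trig_energy \<alpha> X \<omega>)"
      using has_bochner_integral_integral_eq[OF J] by simp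
    also have "\<dots> \<ge> 0" by (intro Bochner_Integration.integral_nonneg) (simp add: trig_energy_nonneg)
    finally have J0: "J \<ge> 0" using N by (simp add: zero_le_mult_iff)
    have "N * Js \<le> K t * t powr (- (\<tau> - s)) * (N * J)"
      unfolding K_def \<rho>_def
    proof (rule bessel_weighted_integral_comparison[OF _ s(2) t trig_energy_nonneg J Js])
      show "real DIM(real^'d) / 2 < s" using s by simp
      fix r assume r: "0 < r" "r \<le> t"
      show "\<exists>I. has_bochner_integral lborel (\<lambda>\<omega>. exp (- r * (norm \<omega>)\<^sup>2) * trig_energy \<alpha> X \<omega>) I \<and>
             1/2 * (\<Sum>x\<in>X. (\<alpha> x)\<^sup>2) * (pi / r) powr (real DIM(real^'d) / 2) \<le> I \<and>
             I \<le> 3/2 * (\<Sum>x\<in>X. (\<alpha> x)\<^sup>2) * (pi / r) powr (real DIM(real^'d) / 2)"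
        using gauss[OF X(1) q sep r(1)] r(2) unfolding t_def by blast
    qed
    hence "N * Js \<le> N * (K t * t powr (- (\<tau> - s)) * J)" by (simp add: mult_ac)
    hence "Js \<le> K t * t powr (- (\<tau> - s)) * J" using N by simp
    also have "\<dots> \<le> K (A * (2 * D)\<^sup>2) * t powr (- (\<tau> - s)) * J"
    proof (intro mult_right_mono J0)
      show "K t \<le> K (A * (2 * D)\<^sup>2)"
        unfolding K_def using \<rho> t tT s(2)
        by (intro add_mono powr_mono2 divide_right_mono mult_right_mono mult_left_mono) auto
    qed auto
    also have "t powr (- (\<tau> - s)) = A powr (- (\<tau> - s)) * q powr (- (2 * (\<tau> - s)))"
    proof -
      have "q\<^sup>2 = q powr 2" using q by (simp add: powr_numeral)
      hence "q\<^sup>2 powr (- (\<tau> - s)) = q powr (- (2 * (\<tau> - s)))"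
        by (simp add: powr_powr algebra_simps)
      thus ?thesis using A q unfolding t_def by (subst powr_mult) auto
    qed
    also have "K (A * (2 * D)\<^sup>2) * (A powr (- (\<tau> - s)) * q powr (- (2 * (\<tau> - s)))) * J
       = c * q powr (- (2 * (\<tau> - s))) * J" by (simp add: c_def mult_ac)
    finally have "Js / (L2_set \<alpha> X)\<^sup>2 \<le> (c * q powr (- (2 * (\<tau> - s))) * J) / (L2_set \<alpha> X)\<^sup>2"
      by (rule divide_right_mono) simp
    thus ?thesis unfolding kernel_rayleigh_quotient_def Js_def J_def q_def by simp
  qed
  with c show ?thesis using that by blast
qed

theorem corollary10:
  fixes \<Omega> :: "(real^'d) set" and \<tau> \<sigma> :: real
  assumes "bounded \<Omega>"
    and "\<tau> > real CARD('d) / 2"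
    and "real CARD('d) / (2 * \<tau>) < \<sigma>" and "\<sigma> \<le> 1"
  shows "\<exists>c>0. \<forall>\<Phi> \<Phi>\<sigma> :: real^'d \<Rightarrow> real.
    fourier_pair \<Phi> (\<lambda>\<omega>. (1 + (norm \<omega>)\<^sup>2) powr (- \<tau>)) \<longrightarrow>
    fourier_pair \<Phi>\<sigma> (\<lambda>\<omega>. (1 + (norm \<omega>)\<^sup>2) powr (- (\<sigma> * \<tau>))) \<longrightarrow>
    (\<forall>(kt :: real^'d \<Rightarrow> real^'d \<Rightarrow> real) (kt\<sigma> :: real^'d \<Rightarrow> real^'d \<Rightarrow> real) C C1.
      C > 0 \<longrightarrow> C1 > 0 \<longrightarrow>
      norm_equivalent_on \<Omega> C (\<lambda>x z. \<Phi> (x - z)) kt \<longrightarrow>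
      norm_equivalent_on \<Omega> C1 (\<lambda>x z. \<Phi>\<sigma> (x - z)) kt\<sigma> \<longrightarrow>
      (\<forall>X \<alpha>. finite X \<longrightarrow> X \<subseteq> \<Omega> \<longrightarrow> (\<exists>x\<in>X. \<alpha> x \<noteq> 0) \<longrightarrow>
        inverse (C1\<^sup>2) * inverse (C\<^sup>2) * kernel_rayleigh_quotient kt X \<alpha>
          \<le> kernel_rayleigh_quotient kt\<sigma> X \<alpha> \<and>
        (card X \<ge> 2 \<longrightarrow>
          kernel_rayleigh_quotient kt\<sigma> X \<alpha>
            \<le> C1\<^sup>2 * C\<^sup>2 * (c * separation_distance X powr (- ((1 - \<sigma>) * 2 * \<tau>)))
                * kernel_rayleigh_quotient kt X \<alpha>)))"
proof -
  have \<tau>: "\<tau> > 0" using assms(2) by (rule le_less_trans[rotated]) simp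
  have s: "real CARD('d) / 2 < \<sigma> * \<tau>" using assms(3) \<tau> by (simp add: field_simps)
  have s\<tau>: "\<sigma> * \<tau> \<le> \<tau>" using assms(4) \<tau> by simp
  have expo: "2 * (\<tau> - \<sigma> * \<tau>) = (1 - \<sigma>) * 2 * \<tau>" by (simp add: algebra_simps)
  obtain c where c: "c > 0"
    and upper: "\<And>(\<Phi> :: real^'d \<Rightarrow> real) \<Phi>\<sigma> X \<alpha>.
      fourier_pair \<Phi> (\<lambda>\<omega>. (1 + (norm \<omega>)\<^sup>2) powr (- \<tau>)) \<Longrightarrow>
      fourier_pair \<Phi>\<sigma> (\<lambda>\<omega>. (1 + (norm \<omega>)\<^sup>2) powr (- (\<sigma> * \<tau>))) \<Longrightarrow>
      finite X \<Longrightarrow> X \<subseteq> \<Omega> \<Longrightarrow> card X \<ge> 2 \<Longrightarrow>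
      kernel_rayleigh_quotient (\<lambda>x z. \<Phi>\<sigma> (x - z)) X \<alpha>
        \<le> c * separation_distance X powr (- ((1 - \<sigma>) * 2 * \<tau>))
            * kernel_rayleigh_quotient (\<lambda>x z. \<Phi> (x - z)) X \<alpha>"
    using bessel_kernel_rayleigh_quotient_comparison[OF assms(1) s s\<tau>] unfolding expo by blast
  show ?thesis
  proof (intro exI[of _ c] conjI c allI impI)
    fix \<Phi> \<Phi>\<sigma> :: "real^'d \<Rightarrow> real" and kt kt\<sigma> :: "real^'d \<Rightarrow> real^'d \<Rightarrow> real" and C C1 X \<alpha>
    assume pair: "fourier_pair \<Phi> (\<lambda>\<omega>. (1 + (norm \<omega>)\<^sup>2) powr (- \<tau>))"
        "fourier_pair \<Phi>\<sigma> (\<lambda>\<omega>. (1 + (norm \<omega>)\<^sup>2) powr (- (\<sigma> * \<tau>)))"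
      and C: "C > 0" "C1 > 0"
      and equiv: "norm_equivalent_on \<Omega> C (\<lambda>x z. \<Phi> (x - z)) kt"
        "norm_equivalent_on \<Omega> C1 (\<lambda>x z. \<Phi>\<sigma> (x - z)) kt\<sigma>"
      and X: "finite X" "X \<subseteq> \<Omega>"
    let ?r = "kernel_rayleigh_quotient (\<lambda>x z. \<Phi> (x - z)) X \<alpha>"
    let ?r\<sigma> = "kernel_rayleigh_quotient (\<lambda>x z. \<Phi>\<sigma> (x - z)) X \<alpha>"
    note cmp = norm_equivalent_on_kernel_rayleigh_quotient[OF equiv(1) C(1) X, of \<alpha>]
    note cmp\<sigma> = norm_equivalent_on_kernel_rayleigh_quotient[OF equiv(2) C(2) X, of \<alpha>]
    have "kernel_rayleigh_quotient kt X \<alpha> \<le> C\<^sup>2 * ?r" by (rule cmp)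
    also have "\<dots> \<le> C\<^sup>2 * ?r\<sigma>"
    proof (intro mult_left_mono kernel_rayleigh_quotient_fourier_mono[OF pair])
      fix \<omega> :: "real^'d"
      show "(1 + (norm \<omega>)\<^sup>2) powr (- \<tau>) \<le> (1 + (norm \<omega>)\<^sup>2) powr (- (\<sigma> * \<tau>))"
        using s\<tau> by (intro powr_mono) auto
    qed simp
    also have "\<dots> \<le> C\<^sup>2 * (C1\<^sup>2 * kernel_rayleigh_quotient kt\<sigma> X \<alpha>)"
      by (intro mult_left_mono cmp\<sigma>) simp
    finally show "inverse (C1\<^sup>2) * inverse (C\<^sup>2) * kernel_rayleigh_quotient kt X \<alpha>
          \<le> kernel_rayleigh_quotient kt\<sigma> X \<alpha>"
      using C by (simp add: field_simps)
    assume card: "card X \<ge> 2"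
    let ?b = "c * separation_distance X powr (- ((1 - \<sigma>) * 2 * \<tau>))"
    have "kernel_rayleigh_quotient kt\<sigma> X \<alpha> \<le> C1\<^sup>2 * ?r\<sigma>" by (rule cmp\<sigma>)
    also have "\<dots> \<le> C1\<^sup>2 * (?b * ?r)"
      using upper[OF pair X card] by (intro mult_left_mono) auto
    also have "\<dots> \<le> C1\<^sup>2 * (?b * (C\<^sup>2 * kernel_rayleigh_quotient kt X \<alpha>))"
      using c by (intro mult_left_mono cmp) auto
    finally show "kernel_rayleigh_quotient kt\<sigma> X \<alpha> \<le> C1\<^sup>2 * C\<^sup>2 * ?b * kernel_rayleigh_quotient kt X \<alpha>"
      by (simp add: mult_ac)
  qed
qed

end
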